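(* Let $\eta:[0,\infty[\to]0,\infty[$ be a decreasing continuous function such that $\lim_{t\to\infty}t^k\eta(t)=0$ for every $k\in\mathbb N$. Let $X$ be a complex Banach space and let $v$ be the weight on $X$ defined by $v(x)=\eta(\|x\|)$ for $x\in X$. Then $$\tilde v(x)=\tilde\eta(\|x\|)\quad\text{for all }x\in X.$$
   Context: For a weight $v$ on $X$ (a continuous bounded function $v:X\to[0,\infty[$), $Hv(X)$ is the space of holomorphic $f:X\to\mathbb C$ with $\|f\|_v:=\sup_{x\in X}v(x)|f(x)|<\infty$, and the associated weight is $$\tilde v(x)=\frac{1}{\sup\{|f(x)|: f\in Hv(X),\ \|f\|_v\le 1\}}.$$ The function $\eta$ is extended radially to a weight on $\mathbb C$ by $\eta(z)=\eta(|z|)$, and its associated weight is $$\tilde\eta(t)=\frac{1}{\sup\{|g(t)|: g\in H(\mathbb C),\ |g|\le 1/\eta\text{ on }\mathbb C\}}.$$ *)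

theory Defs
  imports "HOL-Analysis.Analysis"
begin

section \<open>Complex Banach spaces\<close>

text \<open>
  The library has real normed spaces only.  A complex normed space is a real one
  carrying a multiplication by complex scalars that extends the real one; the unit law
  \<open>scaleC 1 x = x\<close> follows from \<open>scaleC_of_real\<close>.
\<close>

class complex_normed_vector = real_normed_vector +
  fixes scaleC :: "complex \<Rightarrow> 'a \<Rightarrow> 'a"  (infixr \<open>*\<^sub>C\<close> 75)
  assumes scaleC_add_right: "c *\<^sub>C (x + y) = c *\<^sub>C x + c *\<^sub>C y"
    and scaleC_add_left: "(c + d) *\<^sub>C x = c *\<^sub>C x + d *\<^sub>C x"
    and scaleC_scaleC: "c *\<^sub>C (d *\<^sub>C x) = (c * d) *\<^sub>C x"
    and scaleC_of_real: "complex_of_real r *\<^sub>C x = r *\<^sub>R x"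
    and norm_scaleC: "norm (c *\<^sub>C x) = cmod c * norm x"

class complex_banach = complex_normed_vector + banach

instantiation complex :: complex_banach
begin

definition scaleC_complex :: "complex \<Rightarrow> complex \<Rightarrow> complex"
  where "scaleC_complex c x = c * x"

instance
  by standard (simp_all add: scaleC_complex_def algebra_simps norm_mult scaleR_conv_of_real)

end

section \<open>Holomorphic functions on complex normed spaces\<close>

text \<open>
  Frechet differentiability everywhere with complex-linear derivative;
  \<open>has_derivative\<close> supplies real linearity and boundedness of \<open>D\<close>.
\<close>

definition holomorphic :: "('a::complex_normed_vector \<Rightarrow> complex) \<Rightarrow> bool"
  where "holomorphic f \<longleftrightarrow>
    (\<forall>x. \<exists>D. (f has_derivative D) (at x) \<and> (\<forall>c h. D (c *\<^sub>C h) = c * D h))"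

lemma holomorphic_complex_iff:
  fixes f :: "complex \<Rightarrow> complex"
  shows "holomorphic f \<longleftrightarrow> f holomorphic_on UNIV"
proof
  assume hol: "holomorphic f"
  show "f holomorphic_on UNIV"
    unfolding holomorphic_on_def
  proof
    fix x
    obtain D where D: "(f has_derivative D) (at x)"
      and lin: "\<And>c h. D (c *\<^sub>C h) = c * D h"
      using hol unfolding holomorphic_def by metis
    have "D = (*) (D 1)"
    proof
      fix h
      show "D h = D 1 * h"
        using lin[of h 1] by (simp add: scaleC_complex_def mult.commute)
    qed
    then have "(f has_field_derivative D 1) (at x)"
      using D by (simp add: has_field_derivative_def)
    then show "f field_differentiable (at x within UNIV)"
      by (auto simp: field_differentiable_def)
  qed
next
  assume "f holomorphic_on UNIV"
  then have "\<exists>f'. (f has_derivative (*) f') (at x)" for x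
    by (auto simp: holomorphic_on_def field_differentiable_def has_field_derivative_def)
  then show "holomorphic f"
    unfolding holomorphic_def
    by (metis (no_types, lifting) mult.left_commute scaleC_complex_def)
qed

section \<open>Weights and associated weights\<close>

definition is_weight :: "('a::complex_normed_vector \<Rightarrow> real) \<Rightarrow> bool"
  where "is_weight v \<longleftrightarrow> continuous_on UNIV v \<and> bounded (range v) \<and> (\<forall>x. 0 \<le> v x)"

text \<open>
  Suprema are taken in \<open>[0, \<infinity>]\<close>, so that they are never the junk value of a real
  supremum of an unbounded set; there \<open>1 / 0 = \<infinity>\<close> and \<open>1 / \<infinity> = 0\<close>.
\<close>

definition weighted_norm :: "('a::complex_normed_vector \<Rightarrow> real) \<Rightarrow> ('a \<Rightarrow> complex) \<Rightarrow> ennreal"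
  where "weighted_norm v f = (SUP x. ennreal (v x * cmod (f x)))"

definition Hv :: "('a::complex_normed_vector \<Rightarrow> real) \<Rightarrow> ('a \<Rightarrow> complex) set"
  where "Hv v = {f. holomorphic f \<and> weighted_norm v f < \<infinity>}"

definition associated_weight :: "('a::complex_normed_vector \<Rightarrow> real) \<Rightarrow> 'a \<Rightarrow> ennreal"
  where "associated_weight v x =
    1 / (SUP f \<in> {f \<in> Hv v. weighted_norm v f \<le> 1}. ennreal (cmod (f x)))"

text \<open>The associated weight of a strictly positive weight on the complex plane.\<close>

definition entire_associated_weight :: "(complex \<Rightarrow> real) \<Rightarrow> complex \<Rightarrow> ennreal"
  where "entire_associated_weight w t =
    1 / (SUP g \<in> {g. g holomorphic_on UNIV \<and> (\<forall>z. cmod (g z) \<le> 1 / w z)}. ennreal (cmod (g t)))"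

lemma is_weight_radial:
  fixes \<eta> :: "real \<Rightarrow> real"
  assumes pos: "\<And>t. 0 \<le> t \<Longrightarrow> 0 < \<eta> t"
    and decr: "antimono_on {0..} \<eta>"
    and cont: "continuous_on {0..} \<eta>"
  shows "is_weight (\<lambda>x::'a::complex_normed_vector. \<eta> (norm x))"
proof -
  have "continuous_on UNIV (\<lambda>x::'a. \<eta> (norm x))"
    by (rule continuous_on_compose2[OF cont]) (auto intro: continuous_intros)
  moreover have "norm (\<eta> (norm x)) \<le> \<eta> 0" for x :: 'a
    using pos[of "norm x"] monotone_onD[OF decr, of 0 "norm x"] by simp
  then have "bounded (range (\<lambda>x::'a. \<eta> (norm x)))"
    by (auto simp: bounded_iff)
  ultimately show ?thesis
    using pos by (auto simp: is_weight_def less_imp_le)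
qed

end

theory Submission
  imports Defs
begin

text \<open>
  Composing \<open>f\<close> with \<open>z \<mapsto> z x / \<parallel>x\<parallel>\<close> turns competitors on \<open>X\<close> into competitors on the
  plane with the same value at \<open>\<parallel>x\<parallel>\<close>.  Conversely, compose an entire \<open>g\<close> with a complex-linear
  functional of norm at most one sending \<open>x\<close> to \<open>\<parallel>x\<parallel>\<close>, which exists by Hahn-Banach.  Both
  compositions respect the weights because \<open>\<eta>\<close> is decreasing.
\<close>

section \<open>Sublinear functionals and the Hahn-Banach theorem\<close>

definition sublinear :: "('a::real_vector \<Rightarrow> real) \<Rightarrow> bool"
  where "sublinear p \<longleftrightarrow>
    (\<forall>x y. p (x + y) \<le> p x + p y) \<and> (\<forall>c x. 0 \<le> c \<longrightarrow> p (c *\<^sub>R x) = c * p x)"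

lemma sublinear_add: "sublinear p \<Longrightarrow> p (x + y) \<le> p x + p y"
  and sublinear_scale: "sublinear p \<Longrightarrow> 0 \<le> c \<Longrightarrow> p (c *\<^sub>R x) = c * p x"
  by (auto simp: sublinear_def)

lemma sublinear_zero: "sublinear p \<Longrightarrow> p 0 = 0"
  using sublinear_scale[of p 0 0] by simp

lemma sublinear_minus_ge: "sublinear p \<Longrightarrow> - p (- x) \<le> p x"
  using sublinear_add[of p x "- x"] by (simp add: sublinear_zero)

lemma sublinear_norm: "sublinear (norm :: 'a::real_normed_vector \<Rightarrow> real)"
  by (simp add: sublinear_def norm_triangle_ineq)

text \<open>One inequality for positive scalars suffices: applied to \<open>inverse c\<close> at
  \<open>c *\<^sub>R x\<close>, it gives the reverse one.\<close>

lemma sublinearI: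
  assumes add: "\<And>x y. p (x + y) \<le> p x + p y"
    and scale: "\<And>c x. 0 < c \<Longrightarrow> p (c *\<^sub>R x) \<le> c * p x"
    and zero: "p 0 = 0"
  shows "sublinear p"
proof -
  have "p (c *\<^sub>R x) = c * p x" if "0 \<le> c" for c x
  proof (cases "c = 0")
    case False
    with that have c: "0 < c" by simp
    have "p (inverse c *\<^sub>R (c *\<^sub>R x)) \<le> inverse c * p (c *\<^sub>R x)"
      using c by (intro scale) simp
    then have "c * p x \<le> p (c *\<^sub>R x)"
      using c by (simp add: field_simps)
    with scale[OF c] show ?thesis by (simp add: antisym)
  qed (simp add: zero)
  with add show ?thesis by (simp add: sublinear_def)
qed

text \<open>The functional \<open>q y = inf {p (y + t z) - t p z | t \<ge> 0}\<close>.\<close>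

lemma sublinear_improve:
  fixes p :: "'a::real_vector \<Rightarrow> real"
  assumes p: "sublinear p"
  obtains q where "sublinear q" "q \<le> p" "q (- z) \<le> - p z"
proof
  define F where "F y t = p (y + t *\<^sub>R z) - t * p z" for y t
  define q where "q y = (INF t\<in>{0..}. F y t)" for y
  \<comment> \<open>Write \<open>t *\<^sub>R z\<close> as
    \<open>(y + t *\<^sub>R z) + (- y)\<close>. The bound is uniform in \<open>t\<close>, so the
    infimum is a genuine real.\<close>
  have F_ge: "- p (- y) \<le> F y t" if "0 \<le> t" for y t
    using sublinear_add[OF p, of "y + t *\<^sub>R z" "- y"] sublinear_scale[OF p that, of z]
    by (simp add: F_def)
  have bdd: "bdd_below (F y ` {0..})" for y
    by (rule bdd_belowI2[of _ "- p (- y)"]) (simp add: F_ge)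
  have q_le: "q y \<le> F y t" if "0 \<le> t" for y t
    unfolding q_def using that by (intro cINF_lower bdd) simp
  have q_ge: "a \<le> q y" if "\<And>t. 0 \<le> t \<Longrightarrow> a \<le> F y t" for a y
    unfolding q_def using that by (intro cINF_greatest) auto
  show "q \<le> p"
    using q_le[of 0] by (simp add: le_fun_def F_def)
  show "q (- z) \<le> - p z"
    using q_le[of 1 "- z"] by (simp add: F_def sublinear_zero[OF p])
  show "sublinear q"
  proof (rule sublinearI)
    fix x y
    \<comment> \<open>Parameters add under subadditivity. Infima are then taken one at a time, first
      over \<open>t\<close>, then over \<open>s\<close>.\<close>
    have "q (x + y) \<le> F x s + F y t" if "0 \<le> s" "0 \<le> t" for s t
      using q_le[of "s + t" "x + y"] sublinear_add[OF p, of "x + s *\<^sub>R z" "y + t *\<^sub>R z"] that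
      by (simp add: F_def algebra_simps)
    then have "q (x + y) - F x s \<le> q y" if "0 \<le> s" for s
      using that by (intro q_ge) (simp add: algebra_simps)
    then have "q (x + y) - q y \<le> q x"
      by (intro q_ge) (simp add: algebra_simps)
    then show "q (x + y) \<le> q x + q y" by simp
  next
    fix c :: real and x
    assume c: "0 < c"
    have "q (c *\<^sub>R x) \<le> c * F x t" if "0 \<le> t" for t
      using q_le[of "c * t" "c *\<^sub>R x"] sublinear_scale[OF p, of c "x + t *\<^sub>R z"] c that
      by (simp add: F_def algebra_simps)
    then have "q (c *\<^sub>R x) / c \<le> q x"
      using c by (intro q_ge) (simp add: field_simps)
    then show "q (c *\<^sub>R x) \<le> c * q x"
      using c by (simp add: field_simps)
  next
    show "q 0 = 0"
      using q_le[of 0 0] q_ge[of 0 0] by (auto simp: F_def sublinear_zero[OF p] sublinear_scale[OF p])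
  qed
qed

text \<open>Provides the lower bounds for Zorn's lemma as pointwise infima, kept finite by the
  common bound \<open>- p (- x)\<close>.\<close>

lemma sublinear_INF_chain:
  fixes C :: "('a::real_vector \<Rightarrow> real) set"
  assumes ne: "C \<noteq> {}"
    and sub: "\<And>q. q \<in> C \<Longrightarrow> sublinear q"
    and below: "\<And>q. q \<in> C \<Longrightarrow> q \<le> p"
    and chain: "\<And>q r. q \<in> C \<Longrightarrow> r \<in> C \<Longrightarrow> q \<le> r \<or> r \<le> q"
  obtains m where "sublinear m" "\<And>q. q \<in> C \<Longrightarrow> m \<le> q"
proof
  define m where "m x = (INF q\<in>C. q x)" for x
  have bdd: "bdd_below ((\<lambda>q. q x) ` C)" for x
  proof (rule bdd_belowI2[of _ "- p (- x)"])
    fix q assume "q \<in> C"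
    then show "- p (- x) \<le> q x"
      using sublinear_minus_ge[OF sub, of q x] below[of q] le_funD[of q p "- x"] by simp
  qed
  have m_le: "m x \<le> q x" if "q \<in> C" for x q
    unfolding m_def using that by (intro cINF_lower bdd)
  have m_ge: "a \<le> m x" if "\<And>q. q \<in> C \<Longrightarrow> a \<le> q x" for a x
    unfolding m_def using that ne by (intro cINF_greatest)
  show "m \<le> q" if "q \<in> C" for q
    using m_le[OF that] by (simp add: le_fun_def)
  show "sublinear m"
  proof (rule sublinearI)
    fix x y
    have "m (x + y) - q x \<le> r y" if q: "q \<in> C" and r: "r \<in> C" for q r
    proof -
      \<comment> \<open>Only here is the chain property essential: the smaller of \<open>q\<close>
        and \<open>r\<close> is subadditive and lies below both.\<close>
      obtain s where "s \<in> C" "s \<le> q" "s \<le> r"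
        using chain[OF q r] q r by blast
      then show ?thesis
        using m_le[of s "x + y"] sublinear_add[OF sub, of s x y] le_funD[of s q x] le_funD[of s r y]
        by simp
    qed
    then have "m (x + y) - q x \<le> m y" if "q \<in> C" for q
      using that by (intro m_ge)
    then have "m (x + y) - m y \<le> m x"
      by (intro m_ge) (simp add: algebra_simps)
    then show "m (x + y) \<le> m x + m y" by simp
  next
    fix c :: real and x
    assume c: "0 < c"
    have "m (c *\<^sub>R x) \<le> c * q x" if "q \<in> C" for q
      using m_le[OF that, of "c *\<^sub>R x"] sublinear_scale[OF sub[OF that], of c x] c by simp
    then have "m (c *\<^sub>R x) / c \<le> m x"
      using c by (intro m_ge) (simp add: field_simps)
    then show "m (c *\<^sub>R x) \<le> c * m x"
      using c by (simp add: field_simps)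
  next
    show "m 0 = 0"
      using ne sub by (simp add: m_def sublinear_zero)
  qed
qed

text \<open>Oddness turns subadditivity at \<open>- x\<close>, \<open>- y\<close> into
  superadditivity at \<open>x\<close>, \<open>y\<close>, and reduces negative scalars to positive
  ones.\<close>

lemma sublinear_odd_imp_linear:
  assumes p: "sublinear p" and odd: "\<And>z. p (- z) \<le> - p z"
  shows "linear p"
proof (rule linearI)
  have minus: "p (- z) = - p z" for z
    using odd[of z] sublinear_minus_ge[OF p, of z] by simp
  show "p (x + y) = p x + p y" for x y
    using sublinear_add[OF p, of x y] sublinear_add[OF p, of "- x" "- y"]
      minus[of x] minus[of y] minus[of "x + y"] by simp
  show "p (c *\<^sub>R x) = c *\<^sub>R p x" for c x
    using sublinear_scale[OF p, of c x] sublinear_scale[OF p, of "- c" x] minus[of "c *\<^sub>R x"]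
    by (cases "0 \<le> c") auto
qed

text \<open>A minimal sublinear functional cannot be improved, hence is odd and so linear.\<close>

theorem sublinear_dominates_linear:
  fixes p :: "'a::real_vector \<Rightarrow> real"
  assumes p: "sublinear p"
  obtains u where "linear u" "u \<le> p"
proof -
  define A where "A = {q. sublinear q \<and> q \<le> p}"
  \<comment> \<open>Zorn's lemma yields maximal elements, so the order is reversed to obtain a
    minimal one.\<close>
  have "\<exists>m\<in>A. \<forall>q\<in>A. m \<ge> q \<longrightarrow> q = m"
  proof (rule predicate_Zorn)
    show "partial_order_on A (relation_of (\<lambda>q r. q \<ge> r) A)"
      by (rule partial_order_on_relation_ofI) auto
  next
    fix C assume "C \<in> Chains (relation_of (\<lambda>q r. q \<ge> r) A)"
    then have C: "C \<subseteq> A" "\<And>q r. q \<in> C \<Longrightarrow> r \<in> C \<Longrightarrow> q \<le> r \<or> r \<le> q"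
      by (auto simp: Chains_def relation_of_def)
    show "\<exists>m\<in>A. \<forall>q\<in>C. q \<ge> m"
    proof (cases "C = {}")
      case True
      then show ?thesis using p by (auto simp: A_def)
    next
      case False
      then obtain m where m: "sublinear m" "\<And>q. q \<in> C \<Longrightarrow> m \<le> q"
        using sublinear_INF_chain[of C p] C by (auto simp: A_def)
      moreover obtain q where "q \<in> C" using False by blast
      ultimately have "m \<in> A"
        using C(1) order_trans[of m q p] by (auto simp: A_def)
      with m show ?thesis by blast
    qed
  qed
  then obtain m where m: "sublinear m" "m \<le> p"
    and min: "\<And>q. sublinear q \<Longrightarrow> q \<le> m \<Longrightarrow> q = m"
    unfolding A_def by (blast intro: order_trans)
  have "m (- z) \<le> - m z" for z
    using sublinear_improve[OF m(1), of z] min by metis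
  with m show ?thesis
    by (intro that[of m] sublinear_odd_imp_linear)
qed

text \<open>No extension from a line is needed: improving the norm in direction \<open>x\<close>
  first forces every linear functional below the result to take at least the value
  \<open>norm x\<close> at \<open>x\<close>.\<close>

corollary norming_real_functional:
  fixes x :: "'a::real_normed_vector"
  obtains u :: "'a \<Rightarrow> real" where "linear u" "\<And>y. u y \<le> norm y" "u x = norm x"
proof -
  obtain q :: "'a \<Rightarrow> real" where q: "sublinear q" "q \<le> norm" "q (- x) \<le> - norm x"
    by (rule sublinear_improve[OF sublinear_norm])
  obtain u where u: "linear u" "u \<le> q"
    by (rule sublinear_dominates_linear[OF q(1)])
  have le: "u y \<le> norm y" for y
    using le_funD[OF u(2)] le_funD[OF q(2)] order_trans by blast
  have "- u x \<le> - norm x"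
    using le_funD[OF u(2), of "- x"] q(3) linear_neg[OF u(1), of x] by simp
  with le[of x] have "u x = norm x" by simp
  with u(1) le show ?thesis by (rule that)
qed

lemma norming_complex_functional:
  fixes x :: "'a::complex_normed_vector"
  obtains \<phi> :: "'a \<Rightarrow> complex" where "bounded_linear \<phi>" "\<And>c y. \<phi> (c *\<^sub>C y) = c * \<phi> y"
    "\<And>y. cmod (\<phi> y) \<le> norm y" "\<phi> x = complex_of_real (norm x)"
proof -
  obtain u :: "'a \<Rightarrow> real" where u: "linear u" "\<And>y. u y \<le> norm y" "u x = norm x"
    using norming_real_functional[of x] by blast
  \<comment> \<open>The only complex-linear candidate with real part \<open>u\<close>, since Im w =
    - Re (i w).\<close>
  define \<phi> where "\<phi> y = Complex (u y) (- u (\<i> *\<^sub>C y))" for y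
  have uC: "u (c *\<^sub>C y) = Re c * u y + Im c * u (\<i> *\<^sub>C y)" for c y
  proof -
    have "c *\<^sub>C y = Re c *\<^sub>R y + Im c *\<^sub>R (\<i> *\<^sub>C y)"
      by (metis complex_eq scaleC_add_left scaleC_of_real scaleC_scaleC mult.commute)
    then show ?thesis
      using u(1) by (simp add: linear_add linear_scale)
  qed
  have clin: "\<phi> (c *\<^sub>C y) = c * \<phi> y" for c y
    using uC[of c y] uC[of "\<i> * c" y]
    by (simp add: \<phi>_def complex_eq_iff scaleC_scaleC algebra_simps)
  have bound: "cmod (\<phi> y) \<le> norm y" for y
  proof (cases "\<phi> y = 0")
    case False
    \<comment> \<open>A unimodular rotation taking \<open>\<phi> y\<close> to the positive real
      axis, where \<open>\<phi>\<close> agrees with \<open>u\<close>; thus the real bound passes to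
      the modulus.\<close>
    define c where "c = cnj (sgn (\<phi> y))"
    have "c * \<phi> y = complex_of_real (cmod (\<phi> y))"
      using False by (simp add: c_def sgn_eq complex_norm_square[symmetric] field_simps power2_eq_square)
    then have "cmod (\<phi> y) = u (c *\<^sub>C y)"
      by (metis Re_complex_of_real clin \<phi>_def complex.sel(1))
    also have "\<dots> \<le> norm y"
      using u(2)[of "c *\<^sub>C y"] False by (simp add: norm_scaleC c_def norm_sgn)
    finally show ?thesis .
  qed simp
  have add: "\<phi> (y + z) = \<phi> y + \<phi> z" for y z
    using u(1) by (simp add: \<phi>_def complex_eq_iff scaleC_add_right linear_add)
  have "bounded_linear \<phi>"
  proof (rule bounded_linear_intro[where K = 1])
    show "\<phi> (r *\<^sub>R y) = r *\<^sub>R \<phi> y" for r y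
      using clin[of "complex_of_real r" y] by (simp add: scaleC_of_real scaleR_conv_of_real)
  qed (simp_all add: add bound)
  moreover have "\<phi> x = complex_of_real (norm x)"
  proof -
    \<comment> \<open>The real part already exhausts the bound on the modulus, leaving no room for
      an imaginary part.\<close>
    have "Re (\<phi> x) = norm x" by (simp add: \<phi>_def u(3))
    moreover from this have "Im (\<phi> x) = 0"
      using power_mono[OF bound[of x], of 2] by (simp add: cmod_power2)
    ultimately show ?thesis by (simp add: complex_eq_iff)
  qed
  ultimately show ?thesis
    using clin bound that by blast
qed

section \<open>Competitors for the associated weights\<close>

text \<open>Serves both transfers: \<open>L\<close> may map the plane into the space or the space
  onto scalars.\<close>

lemma holomorphic_compose_linear:
  assumes f: "holomorphic f" and L: "bounded_linear L" and clin: "\<And>c h. L (c *\<^sub>C h) = c *\<^sub>C L h"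
  shows "holomorphic (\<lambda>x. f (L x))"
  unfolding holomorphic_def
proof
  fix x
  obtain D where D: "(f has_derivative D) (at (L x))" "\<And>c h. D (c *\<^sub>C h) = c * D h"
    using f unfolding holomorphic_def by blast
  have "((\<lambda>x. f (L x)) has_derivative (\<lambda>h. D (L h))) (at x)"
    using has_derivative_compose[OF bounded_linear_imp_has_derivative[OF L] D(1)] .
  then show "\<exists>D. ((\<lambda>x. f (L x)) has_derivative D) (at x) \<and> (\<forall>c h. D (c *\<^sub>C h) = c * D h)"
    using D(2) clin by (intro exI[of _ "\<lambda>h. D (L h)"]) simp
qed

lemma bounded_linear_scaleC_left:
  fixes x :: "'a::complex_normed_vector"
  shows "bounded_linear (\<lambda>c. c *\<^sub>C x)"
proof (rule bounded_linear_intro[where K = "norm x"])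
  show "(r *\<^sub>R c) *\<^sub>C x = r *\<^sub>R (c *\<^sub>C x)" for r c
    by (simp add: scaleR_conv_of_real flip: scaleC_scaleC scaleC_of_real)
qed (simp_all add: scaleC_add_left norm_scaleC)

lemma weighted_norm_le_1_iff:
  assumes "\<And>x. 0 < v x"
  shows "weighted_norm v f \<le> 1 \<longleftrightarrow> (\<forall>x. cmod (f x) \<le> 1 / v x)"
proof -
  have "v x * cmod (f x) \<le> 1 \<longleftrightarrow> cmod (f x) \<le> 1 / v x" for x
    using assms[of x] by (simp add: field_simps)
  then show ?thesis
    by (simp add: weighted_norm_def SUP_le_iff)
qed

text \<open>Brings the competitors on the space into the form used for the plane; norm at most one
  already implies finite norm.\<close>

lemma unit_ball_Hv:
  assumes "\<And>x. 0 < v x"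
  shows "{f \<in> Hv v. weighted_norm v f \<le> 1} = {f. holomorphic f \<and> (\<forall>x. cmod (f x) \<le> 1 / v x)}"
proof -
  have "weighted_norm v f < \<infinity>" if "weighted_norm v f \<le> 1" for f
    using that by (rule le_less_trans) simp
  then show ?thesis
    unfolding Hv_def weighted_norm_le_1_iff[OF assms, symmetric] by blast
qed

theorem proposition2p1:
  fixes \<eta> :: "real \<Rightarrow> real"
    and v :: "'a::complex_banach \<Rightarrow> real"
  assumes "\<And>t. 0 \<le> t \<Longrightarrow> 0 < \<eta> t"
    and "antimono_on {0..} \<eta>"
    and "continuous_on {0..} \<eta>"
    and "\<And>k::nat. ((\<lambda>t. t ^ k * \<eta> t) \<longlongrightarrow> 0) at_top"
    and "\<And>x. v x = \<eta> (norm x)"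
  shows "\<forall>x. associated_weight v x =
    entire_associated_weight (\<lambda>z. \<eta> (cmod z)) (complex_of_real (norm x))"
proof
  fix x :: 'a
  have v: "0 < v y" for y
    using assms(1,5) by simp
  have recip_mono: "1 / \<eta> s \<le> 1 / \<eta> t" if "0 \<le> s" "s \<le> t" for s t
    using that assms(1)[of t] monotone_onD[OF assms(2), of s t] by (simp add: frac_le)
  let ?F = "{f. holomorphic f \<and> (\<forall>y. cmod (f y) \<le> 1 / v y)}"
  let ?G = "{g. g holomorphic_on UNIV \<and> (\<forall>z. cmod (g z) \<le> 1 / \<eta> (cmod z))}"
  \<comment> \<open>Even the sets of attained moduli coincide, so equality of the suprema needs no
    finiteness or attainment argument.\<close>
  have "(\<lambda>f. cmod (f x)) ` ?F = (\<lambda>g. cmod (g (complex_of_real (norm x)))) ` ?G"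
  proof (rule antisym; rule image_subsetI)
    fix f assume f: "f \<in> ?F"
    \<comment> \<open>\<open>sgn x\<close> is the unit vector along \<open>x\<close>; as
      \<open>sgn 0 = 0\<close>, the case \<open>x = 0\<close> is covered with \<open>L\<close> the
      zero map.\<close>
    define L where "L z = z *\<^sub>C sgn x" for z
    have "(\<lambda>z. f (L z)) holomorphic_on UNIV"
      unfolding holomorphic_complex_iff[symmetric]
      by (rule holomorphic_compose_linear[of f L])
        (use f in \<open>simp_all add: L_def[abs_def] bounded_linear_scaleC_left scaleC_complex_def scaleC_scaleC\<close>)
    moreover have "cmod (f (L z)) \<le> 1 / \<eta> (cmod z)" for z
    proof -
      have "cmod (f (L z)) \<le> 1 / \<eta> (norm (L z))"
        using f assms(5) by simp
      also have "\<dots> \<le> 1 / \<eta> (cmod z)"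
        by (rule recip_mono) (simp_all add: L_def norm_scaleC norm_sgn)
      finally show ?thesis .
    qed
    moreover have "L (complex_of_real (norm x)) = x"
      unfolding L_def scaleC_of_real by (cases "x = 0") (simp_all add: sgn_div_norm)
    ultimately show "cmod (f x) \<in> (\<lambda>g. cmod (g (complex_of_real (norm x)))) ` ?G"
      by (intro image_eqI[of _ _ "\<lambda>z. f (L z)"]) auto
  next
    fix g assume g: "g \<in> ?G"
    obtain \<phi> :: "'a \<Rightarrow> complex"
      where \<phi>: "bounded_linear \<phi>" "\<And>c y. \<phi> (c *\<^sub>C y) = c * \<phi> y"
        "\<And>y. cmod (\<phi> y) \<le> norm y" "\<phi> x = complex_of_real (norm x)"
      using norming_complex_functional[of x] by blast
    have "holomorphic (\<lambda>y. g (\<phi> y))"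
      by (rule holomorphic_compose_linear[of g \<phi>])
        (use g \<phi>(1,2) in \<open>simp_all add: holomorphic_complex_iff scaleC_complex_def\<close>)
    moreover have "cmod (g (\<phi> y)) \<le> 1 / v y" for y
    proof -
      have "cmod (g (\<phi> y)) \<le> 1 / \<eta> (cmod (\<phi> y))"
        using g by simp
      \<comment> \<open>The functional does not increase norms, and 1 / \<open>\<eta>\<close> is
        increasing.\<close>
      also have "\<dots> \<le> 1 / v y"
        unfolding assms(5) by (rule recip_mono) (simp_all add: \<phi>(3))
      finally show ?thesis .
    qed
    ultimately show "cmod (g (complex_of_real (norm x))) \<in> (\<lambda>f. cmod (f x)) ` ?F"
      using \<phi>(4) by (intro image_eqI[of _ _ "\<lambda>y. g (\<phi> y)"]) auto
  qed
  from arg_cong[OF this, of "\<lambda>A. SUP a\<in>A. ennreal a"]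
  show "associated_weight v x =
      entire_associated_weight (\<lambda>z. \<eta> (cmod z)) (complex_of_real (norm x))"
    unfolding associated_weight_def entire_associated_weight_def unit_ball_Hv[of v, OF v]
    by (simp add: image_image)
qed

end
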